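(* Let $\mathcal{A},\mathcal{Z}$ be finite nonempty sets, $r:\mathcal{A}\times\mathcal{Z}\to\mathbb{R}^{\ell}$ ($\ell\ge 1$), and let $S\subseteq\mathbb{R}^{\ell}$ be a closed convex set that is approachable, equivalently (by Blackwell's theorem) such that for every $q\in\Delta(\mathcal{Z})$ there exists $p\in\Delta(\mathcal{A})$ with $r(p,q)\in S$. Let $\lambda_0=0$. Suppose that at each time step $n\ge 1$ the agent chooses its mixed action $p_n\in\Delta(\mathcal{A})$ (from which $a_n$ is sampled) and two additional mixed actions $q_n^*\in\Delta(\mathcal{Z})$ and $p_n^*\in\Delta(\mathcal{A})$ as follows: (i) $p_n$ and $q_n^*$ are equilibrium strategies in the zero-sum game with payoff $\lambda_{n-1}\cdot r(a,z)$, namely $$p_n\in\operatorname*{argmax}_{p\in\Delta(\mathcal{A})}\min_{q\in\Delta(\mathcal{Z})}\lambda_{n-1}\cdot r(p,q),\qquad q_n^*\in\operatorname*{argmin}_{q\in\Delta(\mathcal{Z})}\max_{p\in\Delta(\mathcal{A})}\lambda_{n-1}\cdot r(p,q);$$ (ii) $p_n^*$ is chosen so that $r(p_n^*,q_n^* )\in S$, and $r_n^*:=r(p_n^*,q_n^* )$. Here, for $n\ge1$, $\lambda_n:=\bar r_n^*-\bar r_n$ with $\bar r_n^*=\frac1n\sum_{k=1}^n r_k^*$ and $\bar r_n=\frac1n\sum_{k=1}^n r(p_k,z_k)$, where $z_k\in\mathcal{Z}$ is the opponent's action at time $k$. Then, for any strategy of the opponent (indeed for every realized sequence of opponent actions),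 $$d(\bar r_n,S)\le\|\lambda_n\|\le\frac{\rho}{\sqrt n},\qquad n\ge 1 .$$
   Context: Repeated game: at each time $n=1,2,\dots$ the agent picks a mixed action $p_n\in\Delta(\mathcal{A})$ as a function of the history $(a_1,z_1,\dots,a_{n-1},z_{n-1})$ and samples $a_n\sim p_n$; simultaneously the opponent picks $z_n\in\mathcal{Z}$ (a strategy of the opponent is a sequence of maps from histories to $\Delta(\mathcal{Z})$ from which $z_n$ is sampled). $\Delta(X)$ is the set of probability vectors on the finite set $X$. For $p\in\Delta(\mathcal{A})$, $q\in\Delta(\mathcal{Z})$, $r(p,q)=\sum_{a,z}p(a)q(z)r(a,z)$ and $r(p,z)=\sum_a p(a)r(a,z)$. $\|\cdot\|$ is the Euclidean norm, $d(x,S)=\inf_{s\in S}\|x-s\|$, and $\rho=\max_{a,z,a',z'}\|r(a,z)-r(a',z')\|$. A closed set $S$ is approachable if there is an agent strategy $\pi$ such that for every $\epsilon>0$ there is $N$ such that for every opponent strategy $\sigma$, $\mathbb{P}^{\pi,\sigma}\{d(\bar R_n,S)\ge\epsilon\text{ for some }n\ge N\}<\epsilon$, where $\bar R_n=\frac1n\sum_{k=1}^n r(a_k,z_k)$. Blackwell's theorem: a closed convex set $S$ is approachable if and only if for every $q\in\Delta(\mathcal{Z})$ there is $p\in\Delta(\mathcal{A})$ with $r(p,q)\in S$. *)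

theory Defs
  imports "HOL-Probability.Probability"
begin

text \<open>
  The finite nonempty action sets are the types \<open>'a\<close> and \<open>'z\<close> of class \<^class>\<open>finite\<close>; a mixed
  action is a probability mass function on such a type.
\<close>

definition mixed_reward ::
  "('a::finite \<Rightarrow> 'z::finite \<Rightarrow> 'v::real_vector) \<Rightarrow> 'a pmf \<Rightarrow> 'z pmf \<Rightarrow> 'v" where
  "mixed_reward r p q = (\<Sum>a\<in>UNIV. \<Sum>z\<in>UNIV. (pmf p a * pmf q z) *\<^sub>R r a z)"

definition smoothed_reward ::
  "('a::finite \<Rightarrow> 'z \<Rightarrow> 'v::real_vector) \<Rightarrow> 'a pmf \<Rightarrow> 'z \<Rightarrow> 'v" where
  "smoothed_reward r p z = (\<Sum>a\<in>UNIV. pmf p a *\<^sub>R r a z)"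

definition reward_diameter :: "('a::finite \<Rightarrow> 'z::finite \<Rightarrow> 'v::real_normed_vector) \<Rightarrow> real" where
  "reward_diameter r = Max {norm (r a z - r a' z') | a z a' z'. True}"

text \<open>Sequences in time are indexed from 1; the entry at index 0 is ignored.\<close>

definition time_avg :: "(nat \<Rightarrow> 'v::real_vector) \<Rightarrow> nat \<Rightarrow> 'v" where
  "time_avg x n = (1 / real n) *\<^sub>R (\<Sum>k=1..n. x k)"

text \<open>
  In a play \<open>\<omega> :: nat \<Rightarrow> 'a \<times> 'z\<close> the pair \<open>\<omega> i\<close> consists of the actions taken at time \<open>i + 1\<close>, so
  that \<open>history \<omega> n\<close> is what both players have observed before they act at time \<open>n + 1\<close>.
\<close>

type_synonym ('a, 'z, 'x) strategy = "('a \<times> 'z) list \<Rightarrow> 'x pmf"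

definition history :: "(nat \<Rightarrow> 'a \<times> 'z) \<Rightarrow> nat \<Rightarrow> ('a \<times> 'z) list" where
  "history \<omega> n = map \<omega> [0..<n]"

text \<open>Given the history, the two players randomise independently of each other.\<close>

definition step_measure ::
  "('a, 'z, 'a) strategy \<Rightarrow> ('a, 'z, 'z) strategy \<Rightarrow> nat \<Rightarrow> (nat \<Rightarrow> 'a \<times> 'z) \<Rightarrow> ('a \<times> 'z) measure"
where
  "step_measure \<pi> \<sigma> n \<omega> = measure_pmf (pair_pmf (\<pi> (history \<omega> n)) (\<sigma> (history \<omega> n)))"

text \<open>
  The law of the infinite play, obtained from the conditional laws \<^const>\<open>step_measure\<close> by the
  Ionescu-Tulcea theorem.
\<close>

definition play_measure ::
  "('a, 'z, 'a) strategy \<Rightarrow> ('a, 'z, 'z) strategy \<Rightarrow> (nat \<Rightarrow> 'a \<times> 'z) measure" where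
  "play_measure \<pi> \<sigma> =
     projective_family.lim UNIV
       (Ionescu_Tulcea.CI (step_measure \<pi> \<sigma>) (\<lambda>_. count_space UNIV)) (\<lambda>_. count_space UNIV)"

lemma Ionescu_Tulcea_step_measure:
  fixes \<pi> :: "('a::finite, 'z::finite, 'a) strategy" and \<sigma> :: "('a, 'z, 'z) strategy"
  shows "Ionescu_Tulcea (step_measure \<pi> \<sigma>) (\<lambda>_. count_space UNIV)"
proof (rule Ionescu_Tulcea.intro)
  fix i :: nat
  have "PiM {0..<i} (\<lambda>_. count_space (UNIV :: ('a \<times> 'z) set)) = count_space (PiE {0..<i} (\<lambda>_. UNIV))"
    by (rule count_space_PiM_finite) (auto intro: countable_finite)
  then show "step_measure \<pi> \<sigma> i \<in> PiM {0..<i} (\<lambda>_. count_space UNIV) \<rightarrow>\<^sub>M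
      subprob_algebra (count_space UNIV)"
    by (simp add: step_measure_def[abs_def] measure_pmf_in_subprob_algebra)
next
  show "prob_space (step_measure \<pi> \<sigma> i \<omega>)" for i \<omega>
    unfolding step_measure_def by (rule prob_space_measure_pmf)
qed

lemma space_play_measure [simp]:
  "space (play_measure (\<pi> :: ('a::finite, 'z::finite, 'a) strategy) \<sigma>) = UNIV"
proof -
  interpret IT: Ionescu_Tulcea "step_measure \<pi> \<sigma>" "\<lambda>_. count_space UNIV"
    by (rule Ionescu_Tulcea_step_measure)
  show ?thesis by (simp add: play_measure_def space_PiM)
qed

lemma sets_play_measure [measurable_cong]:
  "sets (play_measure (\<pi> :: ('a::finite, 'z::finite, 'a) strategy) \<sigma>) =
     sets (PiM UNIV (\<lambda>_. count_space UNIV))"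
proof -
  interpret IT: Ionescu_Tulcea "step_measure \<pi> \<sigma>" "\<lambda>_. count_space UNIV"
    by (rule Ionescu_Tulcea_step_measure)
  show ?thesis by (simp add: play_measure_def)
qed

lemma history_Suc: "history \<omega> (Suc n) = history \<omega> n @ [\<omega> n]"
  by (simp add: history_def)

lemma emeasure_play_measure_history:
  fixes \<pi> :: "('a::finite, 'z::finite, 'a) strategy"
  assumes "length h = n"
  shows "emeasure (play_measure \<pi> \<sigma>) {\<omega>. history \<omega> n = h} =
    (\<Prod>i<n. ennreal (pmf (\<pi> (take i h)) (fst (h ! i)) * pmf (\<sigma> (take i h)) (snd (h ! i))))"
proof -
  interpret IT: Ionescu_Tulcea "step_measure \<pi> \<sigma>" "\<lambda>_. count_space UNIV"
    by (rule Ionescu_Tulcea_step_measure)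
  let ?M = "\<lambda>_::nat. count_space (UNIV :: ('a \<times> 'z) set)"
  have PiM: "PiM {0..<i} ?M = count_space (PiE {0..<i} (\<lambda>_. UNIV))" for i
    by (rule count_space_PiM_finite) (auto intro: countable_finite)
  define f where "f h = (\<lambda>i\<in>{0..<length h}. h ! i)" for h :: "('a \<times> 'z) list"
  have C: "emeasure (IT.C 0 n (\<lambda>_. undefined)) {f h} =
    (\<Prod>i<n. ennreal (pmf (\<pi> (take i h)) (fst (h ! i)) * pmf (\<sigma> (take i h)) (snd (h ! i))))"
    if "length h = n" for n h
    using that
  proof (induction n arbitrary: h)
    case 0
    then have "f h = (\<lambda>_. undefined)" by (simp add: f_def restrict_def)
    then show ?case using 0 by (simp add: PiM_empty)
  next
    case (Suc n)
    then obtain g x where h: "h = g @ [x]" "length g = n"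
      by (metis length_Suc_conv_rev)
    have g: "f g \<in> space (PiM {0..<n} ?M)"
      using h by (auto simp: PiM f_def)
    have "f h \<in> PiE {0..<Suc n} (\<lambda>_. UNIV)" using h by (auto simp: f_def)
    then have sets_fh: "{f h} \<in> sets (PiM {0..<Suc n} ?M)" by (subst PiM) simp
    have "emeasure (IT.C 0 (Suc n) (\<lambda>_. undefined)) {f h} =
      (\<integral>\<^sup>+\<omega>. emeasure (IT.eP n \<omega>) {f h} \<partial>IT.C 0 n (\<lambda>_. undefined))"
      using IT.measurable_eP[of n] sets_fh
      by (simp, subst emeasure_bind[where N="PiM {0..<Suc n} ?M"])
         (auto simp: IT.space_C space_PiM measurable_cong_sets[OF IT.sets_C refl])
    also have "\<dots> = (\<integral>\<^sup>+\<omega>. emeasure (step_measure \<pi> \<sigma> n (f g)) {x} * indicator {f g} \<omega>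
        \<partial>IT.C 0 n (\<lambda>_. undefined))"
    proof (rule nn_integral_cong)
      fix \<omega> assume "\<omega> \<in> space (IT.C 0 n (\<lambda>_. undefined))"
      then have \<omega>: "\<omega> \<in> space (PiM {0..<n} ?M)" by (simp add: IT.space_C)
      have fh: "f h = fun_upd (f g) n x"
        using h by (auto simp: f_def fun_eq_iff nth_append)
      have "emeasure (IT.eP n \<omega>) {f h} = emeasure (step_measure \<pi> \<sigma> n \<omega>) {y. fun_upd \<omega> n y = f h}"
        using \<omega> sets_fh by (simp add: IT.emeasure_eP vimage_def)
      also have "{y. fun_upd \<omega> n y = f h} = (if \<omega> = f g then {x} else {})"
      proof -
        have "\<omega> n = f g n" using \<omega> g by (auto simp: PiM PiE_def extensional_def)
        then have "fun_upd \<omega> n y = fun_upd (f g) n x \<longleftrightarrow> \<omega> = f g \<and> y = x" for y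
          by (metis fun_upd_same fun_upd_triv fun_upd_upd)
        then show ?thesis unfolding fh by auto
      qed
      finally show "emeasure (IT.eP n \<omega>) {f h} =
        emeasure (step_measure \<pi> \<sigma> n (f g)) {x} * indicator {f g} \<omega>"
        by simp
    qed
    also have "\<dots> = emeasure (step_measure \<pi> \<sigma> n (f g)) {x} * emeasure (IT.C 0 n (\<lambda>_. undefined)) {f g}"
      using g by (subst nn_integral_cmult_indicator) (auto simp: IT.sets_C PiM)
    also have "emeasure (step_measure \<pi> \<sigma> n (f g)) {x} =
        ennreal (pmf (\<pi> g) (fst x) * pmf (\<sigma> g) (snd x))"
    proof -
      have "history (f g) n = g" using h by (auto simp: history_def f_def intro: nth_equalityI)
      then show ?thesis
        by (cases x) (simp add: step_measure_def emeasure_pmf_single pmf_pair)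
    qed
    also have "emeasure (IT.C 0 n (\<lambda>_. undefined)) {f g} =
      (\<Prod>i<n. ennreal (pmf (\<pi> (take i h)) (fst (h ! i)) * pmf (\<sigma> (take i h)) (snd (h ! i))))"
      using h by (subst Suc.IH) (auto intro!: prod.cong simp: nth_append)
    finally show ?case using h by (simp add: mult.commute nth_append)
  qed
  have fh: "f h \<in> PiE {0..<n} (\<lambda>_. UNIV)" using assms by (auto simp: f_def)
  have "history \<omega> n = h \<longleftrightarrow> restrict \<omega> {0..<n} = f h" for \<omega>
  proof -
    have "history \<omega> n = h \<longleftrightarrow> (\<forall>i<n. \<omega> i = h ! i)"
      using assms by (simp add: history_def list_eq_iff_nth_eq)
    also have "\<dots> \<longleftrightarrow> restrict \<omega> {0..<n} = f h"
      unfolding f_def assms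
      by (metis atLeastLessThan_iff le0 restrict_apply' restrict_ext)
    finally show ?thesis .
  qed
  then have "{\<omega>. history \<omega> n = h} = prod_emb UNIV ?M {0..<n} {f h}"
    by (simp add: prod_emb_def vimage_def)
  then have "emeasure (play_measure \<pi> \<sigma>) {\<omega>. history \<omega> n = h} = emeasure (IT.CI {0..<n}) {f h}"
    using fh unfolding play_measure_def by (simp add: IT.lim PiM)
  also have "\<dots> = emeasure (IT.C 0 n (\<lambda>_. undefined)) {f h}"
    using fh by (subst IT.emeasure_CI[of _ n]) (auto simp: PiM prod_emb_id)
  finally show ?thesis using C[OF assms] by simp
qed

lemma prob_space_play_measure:
  "prob_space (play_measure (\<pi> :: ('a::finite, 'z::finite, 'a) strategy) \<sigma>)"
proof
  show "emeasure (play_measure \<pi> \<sigma>) (space (play_measure \<pi> \<sigma>)) = 1"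
    using emeasure_play_measure_history[of "[]" 0 \<pi> \<sigma>] by (simp add: history_def)
qed

definition empirical_reward ::
  "('a \<Rightarrow> 'z \<Rightarrow> 'v::real_vector) \<Rightarrow> (nat \<Rightarrow> 'a \<times> 'z) \<Rightarrow> nat \<Rightarrow> 'v" where
  "empirical_reward r \<omega> n = (1 / real n) *\<^sub>R (\<Sum>k<n. case \<omega> k of (a, z) \<Rightarrow> r a z)"

text \<open>
  \<^const>\<open>infdist\<close> to the empty set is 0, whereas the infimum of distances to the empty set is
  \<open>\<infinity>\<close>; hence the conjunct \<open>S \<noteq> {}\<close>.
\<close>

definition approachable ::
  "('a::finite \<Rightarrow> 'z::finite \<Rightarrow> 'v::real_normed_vector) \<Rightarrow> 'v set \<Rightarrow> bool" where
  "approachable r S \<longleftrightarrow> S \<noteq> {} \<and>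
    (\<exists>\<pi> :: ('a, 'z, 'a) strategy. \<forall>\<epsilon>>0. \<exists>N. \<forall>\<sigma> :: ('a, 'z, 'z) strategy.
       measure (play_measure \<pi> \<sigma>) {\<omega>. \<exists>n\<ge>N. infdist (empirical_reward r \<omega> n) S \<ge> \<epsilon>} < \<epsilon>)"

lemma approachable_event_measurable:
  fixes r :: "'a::finite \<Rightarrow> 'z::finite \<Rightarrow> 'v::euclidean_space"
  shows "{\<omega>. \<exists>n\<ge>N. infdist (empirical_reward r \<omega> n) S \<ge> \<epsilon>} \<in> sets (play_measure \<pi> \<sigma>)"
proof -
  have [measurable]: "(\<lambda>\<omega>. empirical_reward r \<omega> n) \<in> borel_measurable (play_measure \<pi> \<sigma>)" for n
    unfolding empirical_reward_def by measurable
  have [measurable]: "(\<lambda>x. infdist x S) \<in> borel_measurable borel"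
    by (intro borel_measurable_continuous_onI continuous_intros)
  have "{\<omega> \<in> space (play_measure \<pi> \<sigma>). \<exists>n\<ge>N. infdist (empirical_reward r \<omega> n) S \<ge> \<epsilon>}
      \<in> sets (play_measure \<pi> \<sigma>)"
    by measurable
  then show ?thesis by simp
qed

text \<open>
  The infima and suprema over mixed actions of the payoffs of the scalar game are attained, so that
  \<open>INF\<close> and \<open>SUP\<close> over them are a minimum and a maximum.
\<close>

lemma mixed_reward_INF_attained:
  fixes r :: "'a::finite \<Rightarrow> 'z::finite \<Rightarrow> 'v::real_inner"
  obtains q where "(INF q. c \<bullet> mixed_reward r p q) = c \<bullet> mixed_reward r p q"
    and "\<And>q'. c \<bullet> mixed_reward r p q \<le> c \<bullet> mixed_reward r p q'"
proof -
  define g where "g z = c \<bullet> smoothed_reward r p z" for z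
  have eq: "c \<bullet> mixed_reward r p q = (\<Sum>z\<in>UNIV. pmf q z * g z)" for q
    unfolding mixed_reward_def g_def smoothed_reward_def
    by (subst sum.swap) (simp add: inner_sum_right sum_distrib_left mult_ac)
  obtain z0 where z0: "\<And>z. g z0 \<le> g z"
    using arg_min_if_finite(2)[of UNIV g] by (auto simp: not_less)
  have "c \<bullet> mixed_reward r p (return_pmf z0) = g z0"
    unfolding eq by (simp add: pmf_return indicator_def if_distrib[of "\<lambda>x. x * _"] cong: if_cong)
  moreover have "g z0 \<le> c \<bullet> mixed_reward r p q'" for q'
  proof -
    have "g z0 = (\<Sum>z\<in>UNIV. pmf q' z * g z0)"
      by (simp add: sum_pmf_eq_1 flip: sum_distrib_right)
    also have "\<dots> \<le> c \<bullet> mixed_reward r p q'"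
      unfolding eq by (intro sum_mono mult_left_mono z0) simp
    finally show ?thesis .
  qed
  ultimately have "\<And>q'. c \<bullet> mixed_reward r p (return_pmf z0) \<le> c \<bullet> mixed_reward r p q'"
    by simp
  then show ?thesis
    by (intro that[of "return_pmf z0"] cInf_eq_minimum) auto
qed

lemma mixed_reward_SUP_attained:
  fixes r :: "'a::finite \<Rightarrow> 'z::finite \<Rightarrow> 'v::real_inner"
  obtains p where "(SUP p. c \<bullet> mixed_reward r p q) = c \<bullet> mixed_reward r p q"
    and "\<And>p'. c \<bullet> mixed_reward r p' q \<le> c \<bullet> mixed_reward r p q"
proof -
  have flip: "mixed_reward r p' q = mixed_reward (\<lambda>z a. r a z) q p'" for p'
    unfolding mixed_reward_def by (subst sum.swap) (simp add: mult.commute)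
  obtain p where p: "\<And>p'. - c \<bullet> mixed_reward (\<lambda>z a. r a z) q p \<le> - c \<bullet> mixed_reward (\<lambda>z a. r a z) q p'"
    using mixed_reward_INF_attained[of "- c" "\<lambda>z a. r a z" q] by metis
  then have "\<And>p'. c \<bullet> mixed_reward r p' q \<le> c \<bullet> mixed_reward r p q"
    by (simp add: flip)
  then show ?thesis
    by (intro that[of p] cSup_eq_maximum) auto
qed

end

theory Submission
  imports Defs
begin

text \<open>
  Since \<open>n \<lambda>\<^sub>n = (n - 1) \<lambda>\<^bsub>n-1\<^esub> + (r\<^sub>n\<^sup>* - r(p\<^sub>n, z\<^sub>n))\<close>, expanding the square gives a cross term
  \<open>2 (n - 1) \<lambda>\<^bsub>n-1\<^esub> \<bullet> (r\<^sub>n\<^sup>* - r(p\<^sub>n, z\<^sub>n))\<close>. By the minimax theorem, the value of the game with payoff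
  \<open>\<lambda>\<^bsub>n-1\<^esub> \<bullet> r\<close> separates the two inner products, so the cross term is nonpositive and
  \<open>n\<^sup>2 \<parallel>\<lambda>\<^sub>n\<parallel>\<^sup>2\<close> grows by at most \<open>\<rho>\<^sup>2\<close> per step. The distance bound holds because the average of the
  points \<open>r\<^sub>k\<^sup>*\<close> lies in the convex set \<open>S\<close>.
\<close>

section \<open>Mixed actions as weight vectors\<close>

lemma ex_pmf_eq:
  fixes f :: "'a::finite \<Rightarrow> real"
  assumes "\<And>x. 0 \<le> f x" and "(\<Sum>x\<in>UNIV. f x) = 1"
  shows "\<exists>p. pmf p = f"
proof
  show "pmf (embed_pmf f) = f"
    using assms
    by (intro ext pmf_embed_pmf) (simp_all add: nn_integral_count_space_finite sum_ennreal)
qed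

lemma sum_return_pmf:
  fixes h :: "'a::finite \<Rightarrow> 'v::real_vector"
  shows "(\<Sum>y\<in>UNIV. pmf (return_pmf x) y *\<^sub>R h y) = h x"
proof -
  have "pmf (return_pmf x) y *\<^sub>R h y = (if y = x then h y else 0)" for y
    by (simp add: pmf_return)
  then show ?thesis by simp
qed

section \<open>A minimax alternative by separation\<close>

lemma convex_mixed_payoffs:
  fixes h :: "'z::finite \<Rightarrow> 'v::real_vector"
  shows "convex {\<Sum>z\<in>UNIV. pmf q z *\<^sub>R h z | q. True}"
proof (rule convexI, safe)
  fix q q' :: "'z pmf" and u v :: real
  assume uv: "0 \<le> u" "0 \<le> v" "u + v = 1"
  \<comment> \<open>Mixing \<open>q\<close> and \<open>q'\<close> with weights \<open>u\<close> and
    \<open>v\<close> is again a mixed action, and it realises the combined payoff.\<close>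
  obtain s where s: "pmf s = (\<lambda>z. u * pmf q z + v * pmf q' z)"
    using ex_pmf_eq[of "\<lambda>z. u * pmf q z + v * pmf q' z"] uv
    by (auto simp: sum.distrib sum_pmf_eq_1 simp flip: sum_distrib_left)
  have "u *\<^sub>R (\<Sum>z\<in>UNIV. pmf q z *\<^sub>R h z) + v *\<^sub>R (\<Sum>z\<in>UNIV. pmf q' z *\<^sub>R h z)
      = (\<Sum>z\<in>UNIV. pmf s z *\<^sub>R h z)"
    by (simp add: s scaleR_sum_right scaleR_left_distrib sum.distrib)
  then show "\<exists>s. u *\<^sub>R (\<Sum>z\<in>UNIV. pmf q z *\<^sub>R h z) + v *\<^sub>R (\<Sum>z\<in>UNIV. pmf q' z *\<^sub>R h z)
      = (\<Sum>z\<in>UNIV. pmf s z *\<^sub>R h z) \<and> True"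
    by blast
qed

text \<open>
  Shifting payoffs by \<open>v\<close>, the convex set of payoff vectors misses the open negative orthant, and the
  normal of a separating hyperplane, scaled to total mass 1, is the mixed action sought.
\<close>

lemma minimax_alternative:
  fixes G :: "'a::finite \<Rightarrow> 'z::finite \<Rightarrow> real"
  assumes "\<And>q. \<exists>a. v \<le> (\<Sum>z\<in>UNIV. pmf q z * G a z)"
  shows "\<exists>p. \<forall>z. v \<le> (\<Sum>a\<in>UNIV. pmf p a * G a z)"
proof -
  define h :: "'z \<Rightarrow> real ^ 'a" where "h z = (\<chi> a. G a z - v)" for z
  define N :: "(real ^ 'a) set" where "N = {x. \<forall>a. x $ a < 0}"
  define K where "K = {\<Sum>z\<in>UNIV. pmf q z *\<^sub>R h z | q. True}"
  have h_in_K: "h z \<in> K" for z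
  proof -
    have "h z = (\<Sum>y\<in>UNIV. pmf (return_pmf z) y *\<^sub>R h y)"
      by (simp only: sum_return_pmf)
    then show ?thesis unfolding K_def by blast
  qed
  have "convex N"
    unfolding N_def Collect_all_eq
    by (intro convex_INT)
       (simp_all add: cart_eq_inner_axis convex_halfspace_lt inner_commute[of _ "axis _ _"])
  moreover have "convex K"
    unfolding K_def by (rule convex_mixed_payoffs)
  moreover have "(\<chi> a. - 1) \<in> N"
    by (simp add: N_def)
  moreover have "N \<inter> K = {}"
  proof -
    have "(\<Sum>z\<in>UNIV. pmf q z *\<^sub>R h z) \<notin> N" for q
    proof -
      \<comment> \<open>A row \<open>a\<close> paying at least \<open>v\<close> against
        \<open>q\<close> makes coordinate \<open>a\<close> of the shifted payoff vector
        nonnegative.\<close>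
      obtain a where "v \<le> (\<Sum>z\<in>UNIV. pmf q z * G a z)" using assms by blast
      then have "0 \<le> (\<Sum>z\<in>UNIV. pmf q z *\<^sub>R h z) $ a"
        by (simp add: h_def right_diff_distrib sum_subtractf sum_pmf_eq_1 flip: sum_distrib_right)
      then show ?thesis by (auto simp: N_def not_less)
    qed
    then show ?thesis by (auto simp: K_def)
  qed
  ultimately obtain y b where "y \<noteq> 0" and yN: "\<And>x. x \<in> N \<Longrightarrow> y \<bullet> x \<le> b"
    and yK: "\<And>x. x \<in> K \<Longrightarrow> b \<le> y \<bullet> x"
    using separating_hyperplane_sets[of N K] h_in_K by blast
  \<comment> \<open>Moving \<open>x\<close> by \<open>e > 0\<close> along the all \<open>- 1\<close>
    vector lands in \<open>N\<close>; letting \<open>e\<close> tend to 0 extends the bound to the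
    closed orthant, which contains the origin and the axis vectors tested below.\<close>
  have N_closure: "y \<bullet> x \<le> b" if "\<And>a. x $ a \<le> 0" for x
  proof (rule tendsto_upperbound)
    show "((\<lambda>e. y \<bullet> (x + e *\<^sub>R (\<chi> a. - 1))) \<longlongrightarrow> y \<bullet> x) (at_right 0)"
      by (auto intro!: tendsto_eq_intros)
    have "y \<bullet> (x + e *\<^sub>R (\<chi> a. - 1)) \<le> b" if "0 < e" for e
      using \<open>\<And>a. x $ a \<le> 0\<close> that by (intro yN) (auto simp: N_def intro: le_less_trans)
    then show "\<forall>\<^sub>F e in at_right 0. y \<bullet> (x + e *\<^sub>R (\<chi> a. - 1)) \<le> b"
      by (auto simp: eventually_at_right_less eventually_mono[OF eventually_at_right_less])
  qed simp
  have "0 \<le> b" using N_closure[of 0] by simp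
  have y_nonneg: "0 \<le> y $ a" for a
  proof (rule ccontr)
    assume neg: "\<not> 0 \<le> y $ a"
    \<comment> \<open>If \<open>y $ a < 0\<close>, this axis vector has no positive coordinate, yet
      its inner product with \<open>y\<close> is \<open>b + 1\<close>.\<close>
    have "y \<bullet> axis a ((b + 1) / y $ a) \<le> b"
      using neg \<open>0 \<le> b\<close> by (intro N_closure) (auto simp: axis_def divide_nonneg_neg)
    with neg show False by (simp add: inner_axis)
  qed
  define s where "s = (\<Sum>a\<in>UNIV. y $ a)"
  have "s \<noteq> 0"
    using \<open>y \<noteq> 0\<close> y_nonneg by (auto simp: s_def sum_nonneg_eq_0_iff vec_eq_iff)
  then have "0 < s"
    using y_nonneg by (simp add: s_def sum_nonneg order_less_le)
  obtain p where p: "pmf p = (\<lambda>a. y $ a / s)"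
    using ex_pmf_eq[of "\<lambda>a. y $ a / s"] y_nonneg \<open>0 < s\<close>
    by (auto simp: s_def simp flip: sum_divide_distrib)
  have "v \<le> (\<Sum>a\<in>UNIV. pmf p a * G a z)" for z
  proof -
    \<comment> \<open>The shift by \<open>v\<close> in every coordinate contributes
      \<open>s * v\<close>, so dividing by \<open>s\<close> yields the bound for the normalised
      weights.\<close>
    have "0 \<le> y \<bullet> h z" using yK[OF h_in_K] \<open>0 \<le> b\<close> by (rule order_trans[rotated])
    also have "y \<bullet> h z = (\<Sum>a\<in>UNIV. y $ a * G a z) - s * v"
      by (simp add: inner_vec_def h_def s_def right_diff_distrib sum_subtractf sum_distrib_right)
    finally show ?thesis
      using \<open>0 < s\<close> by (simp add: p field_simps flip: sum_divide_distrib)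
  qed
  then show ?thesis by blast
qed

section \<open>Mixed payoffs and equilibrium strategies\<close>

lemma mixed_reward_eq_sum_smoothed:
  "mixed_reward r p q = (\<Sum>z\<in>UNIV. pmf q z *\<^sub>R smoothed_reward r p z)"
  unfolding mixed_reward_def smoothed_reward_def
  by (subst sum.swap) (simp add: scaleR_sum_right mult.commute)

lemma mixed_reward_return_pmf_left:
  "mixed_reward r (return_pmf a) q = (\<Sum>z\<in>UNIV. pmf q z *\<^sub>R r a z)"
  unfolding mixed_reward_def
  by (simp only: sum_return_pmf flip: scaleR_scaleR scaleR_sum_right)

lemma mixed_reward_return_pmf_right:
  "mixed_reward r p (return_pmf z) = smoothed_reward r p z"
  by (simp only: mixed_reward_eq_sum_smoothed sum_return_pmf)

lemma mixed_reward_eq_sum_pure: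
  "mixed_reward r p q = (\<Sum>a\<in>UNIV. pmf p a *\<^sub>R mixed_reward r (return_pmf a) q)"
  unfolding mixed_reward_return_pmf_left by (simp add: mixed_reward_def scaleR_sum_right)

text \<open>A mean never exceeds the maximum. This replaces a best mixed reply by a pure one, as
  \<open>minimax_alternative\<close> requires.\<close>

lemma mean_le_ex:
  fixes f :: "'a::finite \<Rightarrow> real"
  shows "\<exists>a. (\<Sum>x\<in>UNIV. pmf p x * f x) \<le> f a"
proof (rule ccontr)
  define m where "m = (\<Sum>x\<in>UNIV. pmf p x * f x)"
  assume "\<not> ?thesis"
  then have less: "f a < m" for a by (auto simp: m_def not_le)
  then have "Max (range f) < m" by simp
  moreover have "m \<le> (\<Sum>x\<in>UNIV. pmf p x * Max (range f))"
    unfolding m_def by (intro sum_mono mult_left_mono) auto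
  moreover have "\<dots> = Max (range f)"
    by (simp add: sum_pmf_eq_1 flip: sum_distrib_right)
  ultimately show False by linarith
qed

text \<open>Let \<open>v\<close> be the most the agent can get against \<open>q\<close>. As
  \<open>q\<close> is minimising, every \<open>q'\<close> concedes at least \<open>v\<close>, so by
  the minimax alternative some \<open>p1\<close> secures \<open>v\<close> against every opponent
  action; the maximin action \<open>p\<close> then secures it as well.\<close>

lemma equilibrium_inner_le:
  fixes r :: "'a::finite \<Rightarrow> 'z::finite \<Rightarrow> 'v::real_inner"
  assumes p: "is_arg_max (\<lambda>p'. INF q'. c \<bullet> mixed_reward r p' q') (\<lambda>_. True) p"
    and q: "is_arg_min (\<lambda>q'. SUP p'. c \<bullet> mixed_reward r p' q') (\<lambda>_. True) q"
  shows "c \<bullet> mixed_reward r p' q \<le> c \<bullet> smoothed_reward r p z"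
proof -
  define v where "v = (SUP p'. c \<bullet> mixed_reward r p' q)"
  have "\<exists>a. v \<le> (\<Sum>z\<in>UNIV. pmf q' z * (c \<bullet> r a z))" for q'
  proof -
    have "v \<le> (SUP p'. c \<bullet> mixed_reward r p' q')"
      using q by (auto simp: is_arg_min_def v_def not_less)
    also obtain p0 where "(SUP p'. c \<bullet> mixed_reward r p' q') = c \<bullet> mixed_reward r p0 q'"
      by (rule mixed_reward_SUP_attained)
    also have "c \<bullet> mixed_reward r p0 q'
        = (\<Sum>a\<in>UNIV. pmf p0 a * (c \<bullet> mixed_reward r (return_pmf a) q'))"
      by (subst mixed_reward_eq_sum_pure) (simp add: inner_sum_right)
    also obtain a where "\<dots> \<le> c \<bullet> mixed_reward r (return_pmf a) q'"
      using mean_le_ex[of p0 "\<lambda>a. c \<bullet> mixed_reward r (return_pmf a) q'"] by blast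
    finally show ?thesis
      by (auto simp: mixed_reward_return_pmf_left inner_sum_right)
  qed
  from minimax_alternative[of v "\<lambda>a z. c \<bullet> r a z", OF this]
  obtain p1 where p1: "\<And>z. v \<le> c \<bullet> smoothed_reward r p1 z"
    by (auto simp: smoothed_reward_def inner_sum_right)
  obtain q1 where q1: "(INF q'. c \<bullet> mixed_reward r p1 q') = c \<bullet> mixed_reward r p1 q1"
    by (rule mixed_reward_INF_attained)
  obtain p2 where "v = c \<bullet> mixed_reward r p2 q"
    and p2: "\<And>p'. c \<bullet> mixed_reward r p' q \<le> c \<bullet> mixed_reward r p2 q"
    unfolding v_def using mixed_reward_SUP_attained[of c r q] by blast
  then have "c \<bullet> mixed_reward r p' q \<le> v" by simp
  \<comment> \<open>Averaging the pure bounds for \<open>p1\<close> over its worst opponent reply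
    \<open>q1\<close> turns them into a bound on the infimum.\<close>
  also have "v = (\<Sum>z\<in>UNIV. pmf q1 z * v)" by (simp add: sum_pmf_eq_1 flip: sum_distrib_right)
  also have "\<dots> \<le> (\<Sum>z\<in>UNIV. pmf q1 z * (c \<bullet> smoothed_reward r p1 z))"
    by (intro sum_mono mult_left_mono p1) simp
  also have "\<dots> = (INF q'. c \<bullet> mixed_reward r p1 q')"
    unfolding q1 by (simp add: mixed_reward_eq_sum_smoothed inner_sum_right)
  also have "\<dots> \<le> (INF q'. c \<bullet> mixed_reward r p q')"
    using p by (auto simp: is_arg_max_def not_less)
  also have "\<dots> \<le> c \<bullet> mixed_reward r p (return_pmf z)"
  proof -
    \<comment> \<open>A real infimum bounds its members only if they are bounded below; an attained
      minimum settles this.\<close>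
    obtain q2 where "(INF q'. c \<bullet> mixed_reward r p q') = c \<bullet> mixed_reward r p q2"
      and "\<And>q'. c \<bullet> mixed_reward r p q2 \<le> c \<bullet> mixed_reward r p q'"
      using mixed_reward_INF_attained[of c r p] by blast
    then show ?thesis by simp
  qed
  finally show ?thesis by (simp add: mixed_reward_return_pmf_right)
qed

section \<open>Bounds on reward differences\<close>

lemma norm_diff_le_reward_diameter:
  "norm (r a z - r a' z') \<le> reward_diameter r"
proof -
  have "{norm (r a z - r a' z') | a z a' z'. True}
      = range (\<lambda>(a, z, a', z'). norm (r a z - r a' z'))"
    by (force simp: image_def)
  then have "finite {norm (r a z - r a' z') | a z a' z'. True}"
    by simp
  then show ?thesis
    unfolding reward_diameter_def by (rule Max_ge) blast
qed

text \<open>Both vectors lie in the convex hull of the finitely many pure rewards, and the largest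
  distance within such a hull is attained between two generating points.\<close>

lemma norm_mixed_diff_smoothed_le:
  fixes r :: "'a::finite \<Rightarrow> 'z::finite \<Rightarrow> 'v::euclidean_space"
  shows "norm (mixed_reward r p q - smoothed_reward r p' z) \<le> reward_diameter r"
proof -
  define H where "H = range (\<lambda>(a, z). r a z)"
  have smoothed: "smoothed_reward r p z \<in> convex hull H" for p z
    unfolding smoothed_reward_def
    by (intro convex_sum convex_convex_hull hull_inc)
       (auto simp: sum_pmf_eq_1 H_def)
  have "mixed_reward r p q \<in> convex hull H"
    unfolding mixed_reward_eq_sum_smoothed
    by (intro convex_sum convex_convex_hull smoothed) (auto simp: sum_pmf_eq_1)
  moreover obtain u v where "u \<in> H" "v \<in> H"
    and "\<And>x y. x \<in> convex hull H \<Longrightarrow> y \<in> convex hull H \<Longrightarrow> norm (x - y) \<le> norm (u - v)"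
    using simplex_extremal_le[of H] by (auto simp: H_def)
  moreover have "norm (u - v) \<le> reward_diameter r"
    using \<open>u \<in> H\<close> \<open>v \<in> H\<close> by (auto simp: H_def norm_diff_le_reward_diameter)
  ultimately show ?thesis using smoothed order_trans by blast
qed

lemma time_avg_in_convex:
  assumes "convex S" and "1 \<le> n" and "\<And>k. 1 \<le> k \<Longrightarrow> x k \<in> S"
  shows "time_avg x n \<in> S"
  unfolding time_avg_def scaleR_sum_right using assms by (intro convex_sum) auto

text \<open>Sums instead of averages leave no changing weights in the recursion: expanding the
  square adds at most \<open>B\<^sup>2\<close> per step.\<close>

lemma norm_sum_squared_le:
  fixes x :: "nat \<Rightarrow> 'v::real_inner"
  assumes "\<And>n. norm (x (Suc n)) \<le> B" and "\<And>n. (\<Sum>k=1..n. x k) \<bullet> x (Suc n) \<le> 0"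
  shows "(norm (\<Sum>k=1..n. x k))\<^sup>2 \<le> real n * B\<^sup>2"
proof (induction n)
  case (Suc n)
  have "(norm (\<Sum>k=1..Suc n. x k))\<^sup>2
      = (norm (\<Sum>k=1..n. x k))\<^sup>2 + 2 * ((\<Sum>k=1..n. x k) \<bullet> x (Suc n)) + (norm (x (Suc n)))\<^sup>2"
    by (simp add: power2_norm_eq_inner inner_add_left inner_add_right inner_commute)
  also have "\<dots> \<le> real n * B\<^sup>2 + 2 * 0 + B\<^sup>2"
    using Suc assms by (intro add_mono mult_left_mono power_mono) auto
  finally show ?case by (simp add: algebra_simps)
qed simp

theorem theorem6:
  fixes r :: "'a::finite \<Rightarrow> 'z::finite \<Rightarrow> real ^ 'l"
    and S :: "(real ^ 'l) set"
    and p p_star :: "nat \<Rightarrow> 'a pmf"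
    and q_star :: "nat \<Rightarrow> 'z pmf"
    and z :: "nat \<Rightarrow> 'z"
    and lam :: "nat \<Rightarrow> real ^ 'l"
  assumes "closed S" and "convex S" and "approachable r S"
    and "lam 0 = 0"
    and "\<And>n. n \<ge> 1 \<Longrightarrow>
      lam n = time_avg (\<lambda>k. mixed_reward r (p_star k) (q_star k)) n
            - time_avg (\<lambda>k. smoothed_reward r (p k) (z k)) n"
    and "\<And>n. n \<ge> 1 \<Longrightarrow>
      is_arg_max (\<lambda>p'. INF q'. lam (n - 1) \<bullet> mixed_reward r p' q') (\<lambda>_. True) (p n)"
    and "\<And>n. n \<ge> 1 \<Longrightarrow>
      is_arg_min (\<lambda>q'. SUP p'. lam (n - 1) \<bullet> mixed_reward r p' q') (\<lambda>_. True) (q_star n)"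
    and "\<And>n. n \<ge> 1 \<Longrightarrow> mixed_reward r (p_star n) (q_star n) \<in> S"
  shows "\<forall>n\<ge>1.
    infdist (time_avg (\<lambda>k. smoothed_reward r (p k) (z k)) n) S \<le> norm (lam n) \<and>
    norm (lam n) \<le> reward_diameter r / sqrt (real n)"
proof (intro allI impI)
  fix n :: nat
  assume "1 \<le> n"
  define x where "x k = mixed_reward r (p_star k) (q_star k) - smoothed_reward r (p k) (z k)" for k
  \<comment> \<open>This includes \<open>m = 0\<close>, where the empty sum matches
    \<open>lam 0 = 0\<close>.\<close>
  have sum_x: "(\<Sum>k=1..m. x k) = real m *\<^sub>R lam m" for m
    using assms(4) assms(5)[of m]
    by (cases "m = 0") (simp_all add: time_avg_def x_def sum_subtractf scaleR_diff_right)
  have "(norm (\<Sum>k=1..n. x k))\<^sup>2 \<le> real n * (reward_diameter r)\<^sup>2"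
  proof (rule norm_sum_squared_le)
    show "norm (x (Suc m)) \<le> reward_diameter r" for m
      unfolding x_def by (rule norm_mixed_diff_smoothed_le)
    \<comment> \<open>The equilibrium at time \<open>Suc m\<close> is computed from
      \<open>lam m\<close>. The saddle inequality is used with \<open>p_star (Suc m)\<close> as the
      comparison action and with the realised \<open>z (Suc m)\<close>, whatever it is.\<close>
    have "lam m \<bullet> x (Suc m) \<le> 0" for m
      using equilibrium_inner_le[OF assms(6,7)[of "Suc m", simplified]]
      by (simp add: x_def inner_diff_right)
    then show "(\<Sum>k=1..m. x k) \<bullet> x (Suc m) \<le> 0" for m
      unfolding sum_x by (simp add: mult_nonneg_nonpos)
  qed
  \<comment> \<open>Splitting \<open>n\<close> as \<open>sqrt n * sqrt n\<close> leaves one factor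
    \<open>sqrt n\<close> to cancel; nonnegativity of the diameter then permits removing the
    squares.\<close>
  moreover have "norm (\<Sum>k=1..n. x k) = sqrt n * (sqrt n * norm (lam n))"
    unfolding sum_x by simp
  ultimately have "(sqrt n * (sqrt n * norm (lam n)))\<^sup>2 \<le> (sqrt n * reward_diameter r)\<^sup>2"
    by (simp only: power_mult_distrib[of _ "reward_diameter r"]) simp
  moreover have "0 \<le> reward_diameter r"
    using norm_diff_le_reward_diameter[of r] norm_ge_zero order_trans by blast
  ultimately have "sqrt n * norm (lam n) \<le> reward_diameter r"
    using \<open>1 \<le> n\<close> by (auto dest!: power2_le_imp_le)
  then have "norm (lam n) \<le> reward_diameter r / sqrt n"
    using \<open>1 \<le> n\<close> by (simp add: field_simps)
  moreover have "infdist (time_avg (\<lambda>k. smoothed_reward r (p k) (z k)) n) S \<le> norm (lam n)"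
  proof -
    \<comment> \<open>This average is a point of \<open>S\<close> at distance exactly
      \<open>norm (lam n)\<close> from the averaged smoothed reward.\<close>
    have "time_avg (\<lambda>k. mixed_reward r (p_star k) (q_star k)) n \<in> S"
      using assms(2,8) \<open>1 \<le> n\<close> by (intro time_avg_in_convex)
    then show ?thesis
      using assms(5)[OF \<open>1 \<le> n\<close>] by (simp add: infdist_le2 dist_norm norm_minus_commute)
  qed
  ultimately show "infdist (time_avg (\<lambda>k. smoothed_reward r (p k) (z k)) n) S \<le> norm (lam n) \<and>
    norm (lam n) \<le> reward_diameter r / sqrt (real n)"
    by blast
qed

end
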